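(* Let $X$ be a Hilbert space, let $S=(X;X_k,k\geqslant 1)$ be a system of closed linear subspaces of $X$, and let $\tau>0$. Then $S$ is an absolutely representing system of subspaces in $X$ if and only if there exists $\lambda\in(0,\sqrt{1+\tau^2})$ such that $\tau D(S)$ is a $\lambda$-net for $V_X$.
   Context: $X$ is a Hilbert space over $\mathbb{K}$ ($=\mathbb{R}$ or $\mathbb{C}$). A system $S=(X;X_k,k\geqslant 1)$ of closed linear subspaces of $X$ is an absolutely representing system of subspaces in $X$ if every $x\in X$ can be written as $x=\sum_{k=1}^\infty x_k$ with $x_k\in X_k$ and $\sum_{k=1}^\infty\|x_k\|<\infty$. For a normed space $Z$, $V_Z=\{x\in Z:\|x\|=1\}$; $D(S)=\bigcup_{k=1}^\infty V_{X_k}$ and $\tau D(S)=\{\tau x:x\in D(S)\}$. A set $A$ is a $\lambda$-net for a set $B$ if for every $x\in B$ there exists $y\in A$ with $\|x-y\|\leqslant\lambda$. *)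

theory Defs
  imports "HOL-Analysis.Analysis"
begin

text \<open>
  The scalar fields \<open>\<real>\<close> and \<open>\<complex>\<close>, treated uniformly. The axioms below have exactly these two models
  (see \<open>rc_scalar_cases\<close>).
\<close>

class rc_scalar = real_normed_field +
  fixes scalar_conj :: "'a \<Rightarrow> 'a"
  assumes scalar_conj_add: "scalar_conj (x + y) = scalar_conj x + scalar_conj y"
    and scalar_conj_mult: "scalar_conj (x * y) = scalar_conj x * scalar_conj y"
    and mult_scalar_conj_scaleR: "x * scalar_conj x = (norm x)\<^sup>2 *\<^sub>R 1"

instantiation real :: rc_scalar
begin
definition scalar_conj_real :: "real \<Rightarrow> real" where "scalar_conj_real x = x"
instance
  by standard (simp_all add: scalar_conj_real_def power2_eq_square)
end

instantiation complex :: rc_scalar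
begin
definition scalar_conj_complex :: "complex \<Rightarrow> complex" where "scalar_conj_complex = cnj"
instance
  by standard (simp_all add: scalar_conj_complex_def scaleR_conv_of_real flip: complex_norm_square)
end

lemma mult_scalar_conj: "x * scalar_conj x = (of_real ((norm x)\<^sup>2) :: 'a::rc_scalar)"
  by (simp add: mult_scalar_conj_scaleR of_real_def)

lemma scalar_conj_of_real: "scalar_conj (of_real r) = (of_real r :: 'a::rc_scalar)"
proof (cases "r = 0")
  case True
  have "scalar_conj (0 + 0 :: 'a) = scalar_conj 0 + scalar_conj 0"
    by (rule scalar_conj_add)
  then show ?thesis using True by simp
next
  case False
  have "of_real r * scalar_conj (of_real r) = (of_real r * of_real r :: 'a)"
    unfolding mult_scalar_conj by (simp add: power2_eq_square flip: of_real_mult)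
  then show ?thesis using False by simp
qed

lemma scalar_conj_uminus: "scalar_conj (- x) = - scalar_conj (x :: 'a::rc_scalar)"
  using scalar_conj_mult[of "of_real (- 1)" x] unfolding scalar_conj_of_real by simp

lemma scalar_conj_scalar_conj: "scalar_conj (scalar_conj x) = (x :: 'a::rc_scalar)"
proof (cases "x = 0")
  case True
  then show ?thesis using scalar_conj_of_real[of 0, where 'a = 'a] by simp
next
  case False
  have "norm x * norm (scalar_conj x) = norm x * norm x"
    using arg_cong[OF mult_scalar_conj[of x], of norm] by (simp add: norm_mult power2_eq_square)
  then have n: "norm (scalar_conj x) = norm x" using False by simp
  have "scalar_conj x * scalar_conj (scalar_conj x) = scalar_conj x * x"
    using mult_scalar_conj[of "scalar_conj x"] mult_scalar_conj[of x] n by (simp add: mult.commute)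
  moreover have "scalar_conj x \<noteq> 0" using n False by auto
  ultimately show ?thesis by simp
qed

lemma add_scalar_conj_real: "\<exists>r. x + scalar_conj x = (of_real r :: 'a::rc_scalar)"
proof -
  have 1: "scalar_conj (1 + x) = 1 + scalar_conj x"
    using scalar_conj_of_real[of 1, where 'a = 'a] by (simp add: scalar_conj_add)
  have "x + scalar_conj x = (1 + x) * scalar_conj (1 + x) - 1 - x * scalar_conj x"
    unfolding 1 by (simp add: algebra_simps)
  also have "\<dots> = of_real ((norm (1 + x))\<^sup>2 - 1 - (norm x)\<^sup>2)"
    unfolding mult_scalar_conj by simp
  finally show ?thesis by blast
qed

lemma rc_scalar_cases:
  "(\<forall>x :: 'a::rc_scalar. \<exists>a. x = of_real a) \<or>
   (\<exists>J :: 'a. J * J = - 1 \<and> scalar_conj J = - J \<and> (\<forall>x. \<exists>a b. x = of_real a + of_real b * J))"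
proof (cases "\<forall>x :: 'a. scalar_conj x = x")
  case True
  have "\<exists>a. x = of_real a" for x :: 'a
  proof -
    obtain r where "x + scalar_conj x = of_real r" using add_scalar_conj_real by blast
    then have "x = of_real (r / 2)" using True by (simp add: field_simps)
    then show ?thesis by blast
  qed
  then show ?thesis by blast
next
  case False
  have skew: "scalar_conj (z - scalar_conj z) = - (z - scalar_conj z)" for z :: 'a
    using scalar_conj_add[of z "- scalar_conj z"]
    by (simp add: scalar_conj_uminus scalar_conj_scalar_conj)
  obtain x :: 'a where x: "scalar_conj x \<noteq> x" using False by blast
  define y where "y = x - scalar_conj x"
  define J where "J = of_real (1 / norm y) * y"
  have y0: "y \<noteq> 0" using x by (simp add: y_def)
  have cJ: "scalar_conj J = - J"
    unfolding J_def scalar_conj_mult scalar_conj_of_real unfolding y_def skew by (simp only: mult_minus_right)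
  have "norm J = 1" using y0 by (simp add: J_def norm_mult norm_divide)
  then have JJ: "J * J = - 1"
    using mult_scalar_conj[of J] unfolding cJ by (simp add: minus_equation_iff)
  have "\<exists>a b. z = of_real a + of_real b * J" for z
  proof -
    define w where "w = z - scalar_conj z"
    obtain r where r: "z + scalar_conj z = of_real r" using add_scalar_conj_real by blast
    obtain s where "w * J + scalar_conj (w * J) = of_real s" using add_scalar_conj_real by blast
    then have "2 * (w * J) = of_real s"
      using skew[of z] by (simp add: scalar_conj_mult cJ mult.commute flip: w_def)
    then have "2 * (w * (J * J)) = of_real s * J" by (metis mult.assoc)
    then have w: "2 * w = - of_real s * J" by (simp add: JJ minus_equation_iff)
    have "4 * z = 2 * (z + scalar_conj z) + 2 * w" by (simp add: w_def algebra_simps)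
    then have "4 * z = of_real (2 * r) + of_real (- s) * J" unfolding r w by simp
    then have "z = of_real (r / 2) + of_real (- s / 4) * J" by (simp add: field_simps)
    then show ?thesis by blast
  qed
  then show ?thesis using JJ cJ by blast
qed

text \<open>
  A Hilbert space over the scalar field \<open>'k\<close>. Norm, topology, completeness and multiplication by
  real scalars come from the class \<open>banach\<close>; the inner product is linear in the first argument
  and induces the norm (so positive definiteness is implied).
\<close>

locale hilbert_space = vector_space smul
  for smul :: "'k::rc_scalar \<Rightarrow> 'v::banach \<Rightarrow> 'v" +
  fixes ip :: "'v \<Rightarrow> 'v \<Rightarrow> 'k"
  assumes smul_of_real: "smul (of_real r) x = r *\<^sub>R x"
    and ip_add_left: "ip (x + y) z = ip x z + ip y z"
    and ip_smul_left: "ip (smul c x) y = c * ip x y"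
    and ip_commute: "ip y x = scalar_conj (ip x y)"
    and ip_self: "ip x x = of_real ((norm x)\<^sup>2)"

lemma hilbert_space_real:
  "hilbert_space (scaleR :: real \<Rightarrow> 'a \<Rightarrow> 'a) (inner :: 'a::{real_inner,banach} \<Rightarrow> 'a \<Rightarrow> real)"
  by unfold_locales
    (simp_all add: algebra_simps inner_commute scalar_conj_real_def power2_norm_eq_inner)

lemma hilbert_space_complex:
  "hilbert_space ((*) :: complex \<Rightarrow> complex \<Rightarrow> complex) (\<lambda>x y. x * cnj y)"
  by unfold_locales
    (simp_all add: algebra_simps scalar_conj_complex_def scaleR_conv_of_real complex_norm_square
      flip: of_real_power)

text \<open>Systems of subspaces are indexed by \<open>k \<ge> 1\<close>; the value at index \<open>0\<close> is irrelevant.\<close>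

definition closed_subspace_system ::
    "('k::rc_scalar \<Rightarrow> 'v::banach \<Rightarrow> 'v) \<Rightarrow> (nat \<Rightarrow> 'v set) \<Rightarrow> bool" where
  "closed_subspace_system smul X \<longleftrightarrow> (\<forall>k\<ge>1. module.subspace smul (X k) \<and> closed (X k))"

definition absolutely_representing :: "(nat \<Rightarrow> 'v::real_normed_vector set) \<Rightarrow> bool" where
  "absolutely_representing X \<longleftrightarrow>
     (\<forall>v. \<exists>x. (\<forall>k\<ge>1. x k \<in> X k) \<and> summable (\<lambda>k. norm (x (Suc k))) \<and> (\<lambda>k. x (Suc k)) sums v)"

definition unit_vectors :: "'v::real_normed_vector set \<Rightarrow> 'v set" where
  "unit_vectors Z = {x \<in> Z. norm x = 1}"

definition system_unit_vectors :: "(nat \<Rightarrow> 'v::real_normed_vector set) \<Rightarrow> 'v set" where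
  "system_unit_vectors X = (\<Union>k\<in>{1..}. unit_vectors (X k))"

definition is_net :: "real \<Rightarrow> 'v::real_normed_vector set \<Rightarrow> 'v set \<Rightarrow> bool" where
  "is_net l A B \<longleftrightarrow> (\<forall>x\<in>B. \<exists>y\<in>A. norm (x - y) \<le> l)"

end

theory Submission
  imports Defs
begin

text \<open>
  Write \<open>\<langle>x, y\<rangle>\<close> for the real part of the inner product and \<open>D\<close> for the set of unit vectors of the
  subspaces. Both properties are equivalent to the following: there is \<open>\<delta> > 0\<close> such that every unit
  vector \<open>x\<close> satisfies \<open>\<langle>x, d\<rangle> \<ge> \<delta>\<close> for some \<open>d \<in> D\<close>.

  For the net this is a computation: \<open>\<parallel>x - \<tau> d\<parallel>\<^sup>2 = 1 + \<tau>\<^sup>2 - 2 \<tau> \<langle>x, d\<rangle>\<close> for unit vectors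
  \<open>x\<close> and \<open>d\<close>, so the distance is bounded away from \<open>sqrt (1 + \<tau>\<^sup>2)\<close> exactly when \<open>\<langle>x, d\<rangle>\<close> is bounded
  away from \<open>0\<close> (\<open>net_iff_norming\<close>).

  If the condition holds, then subtracting from \<open>x\<close> its component \<open>\<langle>x, d\<rangle> d\<close> along a suitable \<open>d \<in> D\<close>
  shrinks the norm at least by the factor \<open>sqrt (1 - \<delta>\<^sup>2) < 1\<close>. Iterating this yields a geometrically convergent
  expansion of \<open>x\<close>, whose terms are then grouped by subspace (\<open>representing_if_contraction\<close>).

  Conversely, let \<open>S\<close> be absolutely representing. If \<open>c \<ge> 0\<close> bounds \<open>\<langle>x, \<cdot>\<rangle>\<close> on \<open>D\<close>, then a
  representation \<open>v = \<Sum> v\<^sub>k\<close> gives \<open>\<langle>x, v\<rangle> \<le> c \<Sum> \<parallel>v\<^sub>k\<parallel>\<close>. Hence the closed sets of those \<open>v\<close> for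
  which \<open>\<langle>x, v\<rangle> \<le> m c\<close> holds for all such \<open>x\<close> and \<open>c\<close>, where \<open>m = 0, 1, \<dots>\<close>, cover the space.
  By Baire's theorem one of them contains a ball; since \<open>- a\<close>, for its centre \<open>a\<close>, lies in another one,
  \<open>\<langle>x, w\<rangle> \<le> M c\<close> for all \<open>w\<close> in some ball around the origin. Taking \<open>w\<close> parallel to \<open>x\<close> bounds \<open>c\<close> from below (\<open>norming_if_representing\<close>).
\<close>

section \<open>The real part of the inner product\<close>

text \<open>
  The real part of the inner product, given by the polarization identity. In this form it is a
  real-valued function whatever the scalar field is.
\<close>

definition re_inner :: "'v::real_normed_vector \<Rightarrow> 'v \<Rightarrow> real" where
  "re_inner x y = ((norm (x + y))\<^sup>2 - (norm (x - y))\<^sup>2) / 4"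

lemma re_inner_commute: "re_inner x y = re_inner y x"
  by (simp add: re_inner_def add.commute norm_minus_commute)

lemma re_inner_self: "re_inner x x = (norm x)\<^sup>2"
proof -
  have "norm (x + x) = 2 * norm x"
    using norm_scaleR[of 2 x] by (simp add: scaleR_2)
  then show ?thesis
    by (simp add: re_inner_def power_mult_distrib)
qed

context hilbert_space
begin

lemma ip_add_right: "ip z (x + y) = ip z x + ip z y"
  by (metis ip_add_left ip_commute scalar_conj_add)

lemma ip_scaleR_left: "ip (r *\<^sub>R x) y = of_real r * ip x y"
  by (metis ip_smul_left smul_of_real)

lemma ip_scaleR_right: "ip x (r *\<^sub>R y) = of_real r * ip x y"
  by (metis ip_commute ip_scaleR_left scalar_conj_mult scalar_conj_of_real)

lemma of_real_re_inner: "2 * of_real (re_inner x y) = ip x y + ip y x"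
proof -
  have "of_real ((norm (x + y))\<^sup>2) = ip x x + ip y y + (ip x y + ip y x)"
    by (simp add: ip_self[symmetric] ip_add_left ip_add_right del: of_real_power)
  moreover have "of_real ((norm (x - y))\<^sup>2) = ip x x + ip y y - (ip x y + ip y x)"
  proof -
    have "of_real ((norm (x - y))\<^sup>2) = ip (x + (- 1) *\<^sub>R y) (x + (- 1) *\<^sub>R y)"
      by (simp add: ip_self)
    then show ?thesis
      unfolding ip_add_left ip_add_right ip_scaleR_left ip_scaleR_right
      by (simp add: algebra_simps)
  qed
  ultimately have "of_real ((norm (x + y))\<^sup>2 - (norm (x - y))\<^sup>2) = 2 * (ip x y + ip y x)"
    by (simp del: of_real_power)
  also have "(norm (x + y))\<^sup>2 - (norm (x - y))\<^sup>2 = 2 * (2 * re_inner x y)"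
    by (simp add: re_inner_def)
  finally show ?thesis
    unfolding of_real_mult of_real_numeral by (metis mult_cancel_left zero_neq_numeral)
qed

lemma re_inner_add_right:
  fixes x y z :: 'v
  shows "re_inner x (y + z) = re_inner x y + re_inner x z"
proof -
  have "(2 :: 'k) * of_real (re_inner x (y + z)) = 2 * of_real (re_inner x y + re_inner x z)"
    unfolding of_real_add distrib_left of_real_re_inner by (simp add: ip_add_left ip_add_right)
  then show ?thesis
    unfolding mult_cancel_left of_real_eq_iff by simp
qed

lemma re_inner_scaleR_right:
  fixes x y :: 'v
  shows "re_inner x (r *\<^sub>R y) = r * re_inner x y"
proof -
  have "(2 :: 'k) * of_real (re_inner x (r *\<^sub>R y)) = of_real r * (2 * of_real (re_inner x y))"
    unfolding of_real_re_inner by (simp add: ip_scaleR_left ip_scaleR_right distrib_left)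
  also have "\<dots> = 2 * of_real (r * re_inner x y)"
    by simp
  finally show ?thesis
    unfolding mult_cancel_left of_real_eq_iff by simp
qed

lemma norm_diff_scaleR_sq:
  fixes x y :: 'v
  shows "(norm (x - t *\<^sub>R y))\<^sup>2 = (norm x)\<^sup>2 - 2 * t * re_inner x y + t\<^sup>2 * (norm y)\<^sup>2"
proof -
  have "(norm (x + (- t) *\<^sub>R y))\<^sup>2
      = re_inner (x + (- t) *\<^sub>R y) x + (- t) * re_inner (x + (- t) *\<^sub>R y) y"
    by (simp only: re_inner_add_right re_inner_scaleR_right flip: re_inner_self)
  also have "\<dots> = re_inner x x - t * re_inner x y - t * (re_inner x y - t * re_inner y y)"
    unfolding re_inner_commute[of "x + (- t) *\<^sub>R y"]
    by (simp only: re_inner_add_right re_inner_scaleR_right re_inner_commute[of y x])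
       (simp add: algebra_simps)
  finally show ?thesis
    by (simp add: re_inner_self power2_eq_square algebra_simps)
qed

lemma re_inner_le_norm:
  fixes x y :: 'v
  shows "re_inner x y \<le> norm x * norm y"
proof (cases "x = 0 \<or> y = 0")
  case True
  then show ?thesis
    by (auto simp: re_inner_def)
next
  case False
  then have "0 < norm x * norm y" by simp
  moreover have "0 \<le> (norm (norm y *\<^sub>R x - norm x *\<^sub>R y))\<^sup>2" by simp
  then have "0 \<le> 2 * (norm x * norm y) * (norm x * norm y - re_inner x y)"
    unfolding norm_diff_scaleR_sq re_inner_commute[of "norm y *\<^sub>R x"] re_inner_scaleR_right
      re_inner_commute[of y x]
    by (simp add: power2_eq_square algebra_simps)
  ultimately show ?thesis
    by (simp add: zero_le_mult_iff)
qed

lemma bounded_linear_re_inner: "bounded_linear (re_inner (x :: 'v))"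
proof (rule bounded_linear_intro[where K = "norm x"])
  fix y :: 'v
  have "- re_inner x y \<le> norm x * norm y"
    using re_inner_le_norm[of x "(- 1) *\<^sub>R y"] unfolding re_inner_scaleR_right by simp
  then show "norm (re_inner x y) \<le> norm y * norm x"
    using re_inner_le_norm[of x y] by (simp add: mult.commute)
qed (simp_all add: re_inner_add_right re_inner_scaleR_right)

lemma real_subspace_if_subspace:
  assumes "subspace Z"
  shows "real_vector.subspace Z"
  using assms unfolding subspace_def real_vector.subspace_def by (metis smul_of_real)

end

section \<open>Norming systems and nets\<close>

text \<open>
  A set \<open>D\<close> is norming with constant \<open>\<delta>\<close> if every unit vector has real inner product at least
  \<open>\<delta>\<close> with some element of \<open>D\<close>.
\<close>

definition norming :: "real \<Rightarrow> 'v::real_normed_vector set \<Rightarrow> bool" where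
  "norming \<delta> D \<longleftrightarrow> (\<forall>x. norm x = 1 \<longrightarrow> (\<exists>d\<in>D. \<delta> \<le> re_inner x d))"

lemma (in hilbert_space) net_iff_norming:
  fixes D :: "'v set"
  assumes D: "\<And>d. d \<in> D \<Longrightarrow> norm d = 1" and "\<tau> > 0"
  shows "(\<exists>l. 0 < l \<and> l < sqrt (1 + \<tau>\<^sup>2) \<and> is_net l ((\<lambda>d. \<tau> *\<^sub>R d) ` D) (unit_vectors UNIV))
    \<longleftrightarrow> (\<exists>\<delta>>0. norming \<delta> D)"
proof
  have dist: "(norm (x - \<tau> *\<^sub>R d))\<^sup>2 = 1 + \<tau>\<^sup>2 - 2 * \<tau> * re_inner x d"
    if "norm x = 1" "d \<in> D" for x d
    using that D unfolding norm_diff_scaleR_sq by simp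
  {
    assume "\<exists>l. 0 < l \<and> l < sqrt (1 + \<tau>\<^sup>2) \<and> is_net l ((\<lambda>d. \<tau> *\<^sub>R d) ` D) (unit_vectors UNIV)"
    then obtain l where l: "0 < l" "l < sqrt (1 + \<tau>\<^sup>2)"
      and net: "is_net l ((\<lambda>d. \<tau> *\<^sub>R d) ` D) (unit_vectors UNIV)"
      by blast
    have "l\<^sup>2 < 1 + \<tau>\<^sup>2"
      using l by (simp flip: real_sqrt_less_iff[of "l\<^sup>2"])
    then have "(1 + \<tau>\<^sup>2 - l\<^sup>2) / (2 * \<tau>) > 0"
      using \<open>\<tau> > 0\<close> by simp
    moreover have "norming ((1 + \<tau>\<^sup>2 - l\<^sup>2) / (2 * \<tau>)) D"
      unfolding norming_def
    proof (intro allI impI)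
      fix x :: 'v
      assume x: "norm x = 1"
      then obtain d where d: "d \<in> D" "norm (x - \<tau> *\<^sub>R d) \<le> l"
        using net unfolding is_net_def unit_vectors_def by auto
      then have "(norm (x - \<tau> *\<^sub>R d))\<^sup>2 \<le> l\<^sup>2"
        by (simp add: power_mono)
      then have "(1 + \<tau>\<^sup>2 - l\<^sup>2) / (2 * \<tau>) \<le> re_inner x d"
        using dist[OF x d(1)] \<open>\<tau> > 0\<close> by (simp add: field_simps)
      then show "\<exists>d\<in>D. (1 + \<tau>\<^sup>2 - l\<^sup>2) / (2 * \<tau>) \<le> re_inner x d"
        using d(1) by blast
    qed
    ultimately show "\<exists>\<delta>>0. norming \<delta> D" by blast
  next
    assume "\<exists>\<delta>>0. norming \<delta> D"
    then obtain \<delta> where "\<delta> > 0" and nd: "norming \<delta> D" by blast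
    \<comment> \<open>The maximum keeps the radius positive even if \<open>1 + \<tau>\<^sup>2 \<le> 2 \<tau> \<delta>\<close>.\<close>
    define m where "m = max (1 + \<tau>\<^sup>2 - 2 * \<tau> * \<delta>) ((1 + \<tau>\<^sup>2) / 2)"
    have pos: "0 < 1 + \<tau>\<^sup>2"
      by (simp add: add_pos_nonneg)
    then have m: "0 < m" "m < 1 + \<tau>\<^sup>2"
      using \<open>\<delta> > 0\<close> \<open>\<tau> > 0\<close> by (auto simp: m_def less_max_iff_disj)
    have "is_net (sqrt m) ((\<lambda>d. \<tau> *\<^sub>R d) ` D) (unit_vectors UNIV)"
      unfolding is_net_def
    proof
      fix x :: 'v
      assume "x \<in> unit_vectors UNIV"
      then have x: "norm x = 1"
        by (simp add: unit_vectors_def)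
      then obtain d where d: "d \<in> D" "\<delta> \<le> re_inner x d"
        using nd by (auto simp: norming_def)
      have "\<tau> * \<delta> \<le> \<tau> * re_inner x d"
        using d(2) \<open>\<tau> > 0\<close> by simp
      then have "(norm (x - \<tau> *\<^sub>R d))\<^sup>2 \<le> m"
        unfolding dist[OF x d(1)] m_def by simp
      then have "norm (x - \<tau> *\<^sub>R d) \<le> sqrt m"
        by (rule real_le_rsqrt)
      then show "\<exists>y\<in>(\<lambda>d. \<tau> *\<^sub>R d) ` D. norm (x - y) \<le> sqrt m"
        using d(1) by blast
    qed
    then show "\<exists>l. 0 < l \<and> l < sqrt (1 + \<tau>\<^sup>2) \<and> is_net l ((\<lambda>d. \<tau> *\<^sub>R d) ` D) (unit_vectors UNIV)"
      using m by (intro exI[of _ "sqrt m"]) simp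
  }
qed

section \<open>Norming systems are absolutely representing\<close>

lemma has_sum_in_closed_subspace:
  assumes "subspace Z" "closed Z" "(u has_sum s) A" "\<And>j. j \<in> A \<Longrightarrow> u j \<in> Z"
  shows "s \<in> Z"
proof (rule Lim_in_closed_set)
  show "(sum u \<longlongrightarrow> s) (finite_subsets_at_top A)"
    using assms(3) by (simp add: has_sum_def)
  show "eventually (\<lambda>F. sum u F \<in> Z) (finite_subsets_at_top A)"
    using assms(1,4) by (intro eventually_finite_subsets_at_top_weakI subspace_sum) auto
qed (use assms(2) in auto)

text \<open>The terms of an absolutely convergent series may be grouped according to a labelling \<open>\<kappa>\<close>.\<close>

lemma sums_grouped:
  fixes u :: "nat \<Rightarrow> 'v::banach" and \<kappa> :: "nat \<Rightarrow> nat"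
  assumes abs: "summable (\<lambda>j. norm (u j))" and v: "u sums v"
  obtains s where "\<And>k. (u has_sum s k) {j. \<kappa> j = k}" "summable (\<lambda>k. norm (s k))" "s sums v"
proof -
  define A where "A k = {j. \<kappa> j = k}" for k
  define f where "f = (\<lambda>(k :: nat, j). u j)"
  define s where "s k = infsum u (A k)" for k
  have bij: "bij_betw (\<lambda>j. (\<kappa> j, j)) UNIV (Sigma UNIV A)"
    by (auto simp: bij_betw_def inj_on_def A_def)
  have "(f has_sum v) (Sigma UNIV A)"
    using norm_summable_imp_has_sum[OF abs v] has_sum_reindex_bij_betw[OF bij, of f v]
    by (simp add: f_def)
  have "(\<lambda>j. norm (u j)) summable_on UNIV"
    using abs by (simp add: summable_on_UNIV_nonneg_real_iff)
  then have "(\<lambda>p. norm (f p)) summable_on Sigma UNIV A"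
    using summable_on_reindex_bij_betw[OF bij, of "\<lambda>p. norm (f p)"] by (simp add: f_def)
  then have A: "(\<lambda>j. norm (u j)) summable_on A k"
    and tot: "(\<lambda>k. norm (infsum (\<lambda>j. norm (u j)) (A k))) summable_on UNIV" for k
    unfolding Infinite_Sum.abs_summable_on_Sigma_iff by (simp_all add: f_def)
  have s: "(u has_sum s k) (A k)" for k
    unfolding s_def by (rule has_sum_infsum[OF abs_summable_summable[OF A]])
  have "norm (s k) \<le> norm (infsum (\<lambda>j. norm (u j)) (A k))" for k
    unfolding s_def using norm_infsum_bound[OF A] by (rule order_trans) simp
  then have "(\<lambda>k. norm (s k)) summable_on UNIV"
    using Infinite_Sum.abs_summable_on_comparison_test[OF tot, of s] by simp
  moreover have "(s has_sum v) UNIV"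
    using has_sum_SigmaD[OF \<open>(f has_sum v) (Sigma UNIV A)\<close>, of s] s by (simp add: f_def)
  ultimately show thesis
    using s by (intro that[of s]) (auto simp: A_def has_sum_imp_sums intro: summable_on_imp_summable)
qed

text \<open>
  A greedy algorithm: if a single step of approximation from the subspaces shrinks every vector by a
  fixed factor, iterating it on the remainders represents every vector.
\<close>

lemma representing_if_contraction:
  fixes X :: "nat \<Rightarrow> 'v::banach set"
  assumes X: "\<And>k. k \<ge> 1 \<Longrightarrow> subspace (X k) \<and> closed (X k)"
    and q: "0 \<le> q" "q < 1"
    and step: "\<And>x. \<exists>k\<ge>1. \<exists>w\<in>X k. norm w \<le> C * norm x \<and> norm (x - w) \<le> q * norm x"
  shows "absolutely_representing X"
  unfolding absolutely_representing_def
proof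
  fix v :: 'v
  obtain K W where KW: "\<And>x. K x \<ge> 1" "\<And>x. W x \<in> X (K x)"
      "\<And>x. norm (W x) \<le> C * norm x" "\<And>x. norm (x - W x) \<le> q * norm x"
    using step by metis
  define r where "r n = ((\<lambda>x. x - W x) ^^ n) v" for n
  define u where "u n = W (r n)" for n
  have r_Suc: "r (Suc n) = r n - u n" for n
    by (simp add: r_def u_def)
  have r: "norm (r n) \<le> q ^ n * norm v" for n
  proof (induction n)
    case (Suc n)
    have "norm (r (Suc n)) \<le> q * norm (r n)"
      unfolding r_Suc u_def by (rule KW(4))
    also have "\<dots> \<le> q * (q ^ n * norm v)"
      using Suc q(1) by (rule mult_left_mono)
    finally show ?case by simp
  qed (simp add: r_def)
  have geo: "summable (\<lambda>n. q ^ n * norm v)"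
    using q by (intro summable_mult2 summable_geometric) simp
  have "summable (\<lambda>n. norm (u n))"
  proof (rule summable_comparison_test'[where N = 0])
    show "summable (\<lambda>n. \<bar>C\<bar> * (q ^ n * norm v))"
      using geo by (rule summable_mult)
    show "norm (norm (u n)) \<le> \<bar>C\<bar> * (q ^ n * norm v)" for n
    proof -
      have "norm (u n) \<le> C * norm (r n)"
        unfolding u_def by (rule KW(3))
      also have "\<dots> \<le> \<bar>C\<bar> * norm (r n)"
        by (simp add: mult_right_mono)
      also have "\<dots> \<le> \<bar>C\<bar> * (q ^ n * norm v)"
        using r by (rule mult_left_mono) simp
      finally show ?thesis by simp
    qed
  qed
  moreover have "u sums v"
  proof -
    have "(\<Sum>i<n. u i) = v - r n" for n
    proof (induction n)
      case (Suc n)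
      then show ?case by (simp add: r_Suc)
    qed (simp add: r_def)
    moreover have "r \<longlonglongrightarrow> 0"
      using r by (intro Lim_null_comparison[OF _ summable_LIMSEQ_zero[OF geo]]) simp
    then have "(\<lambda>n. v - r n) \<longlonglongrightarrow> v - 0"
      by (intro tendsto_intros)
    ultimately show ?thesis by (simp add: sums_def)
  qed
  \<comment> \<open>The terms \<open>s k\<close> are indexed from \<open>0\<close>, the subspaces from \<open>1\<close>.\<close>
  ultimately obtain s where s: "\<And>k. (u has_sum s k) {j. K (r j) - 1 = k}"
      "summable (\<lambda>k. norm (s k))" "s sums v"
    by (rule sums_grouped[where \<kappa> = "\<lambda>j. K (r j) - 1"]) blast
  have "s (k - 1) \<in> X k" if "k \<ge> 1" for k
  proof (rule has_sum_in_closed_subspace[OF _ _ s(1)])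
    show "u j \<in> X k" if "j \<in> {j. K (r j) - 1 = k - 1}" for j
    proof -
      have "K (r j) = k"
        using that \<open>k \<ge> 1\<close> KW(1)[of "r j"] by auto
      then show ?thesis
        unfolding u_def using KW(2)[of "r j"] by simp
    qed
  qed (use X that in auto)
  then show "\<exists>x. (\<forall>k\<ge>1. x k \<in> X k) \<and> summable (\<lambda>k. norm (x (Suc k))) \<and> (\<lambda>k. x (Suc k)) sums v"
    using s(2,3) by (intro exI[of _ "\<lambda>k. s (k - 1)"]) simp
qed

lemma (in hilbert_space) representing_if_norming:
  fixes X :: "nat \<Rightarrow> 'v set"
  assumes X: "\<And>k. k \<ge> 1 \<Longrightarrow> real_vector.subspace (X k) \<and> closed (X k)"
    and "\<delta> > 0" and nd: "norming \<delta> (system_unit_vectors X)"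
  shows "absolutely_representing X"
proof (rule representing_if_contraction[OF X])
  \<comment> \<open>In the zero space \<open>norming\<close> is vacuous and \<open>\<delta> > 1\<close> is possible, hence the minimum.\<close>
  define q where "q = sqrt (1 - (min \<delta> 1)\<^sup>2)"
  have m: "0 < min \<delta> 1" "min \<delta> 1 \<le> 1"
    using \<open>\<delta> > 0\<close> by auto
  then have m2: "0 < (min \<delta> 1)\<^sup>2" "(min \<delta> 1)\<^sup>2 \<le> 1"
    using power_le_one[of "min \<delta> 1" 2] by auto
  then show "0 \<le> q" "q < 1"
    unfolding q_def by simp_all
  have q2: "q\<^sup>2 = 1 - (min \<delta> 1)\<^sup>2"
    unfolding q_def using m2(2) by simp
  fix x :: 'v
  show "\<exists>k\<ge>1. \<exists>w\<in>X k. norm w \<le> 1 * norm x \<and> norm (x - w) \<le> q * norm x"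
  proof (cases "x = 0")
    case True
    then show ?thesis
      using X[of 1] by (auto intro!: exI[of _ 1] bexI[of _ 0] simp: real_vector.subspace_0)
  next
    case False
    have "norm ((1 / norm x) *\<^sub>R x) = 1"
      using False by simp
    then obtain d where "d \<in> system_unit_vectors X" and d: "\<delta> \<le> re_inner ((1 / norm x) *\<^sub>R x) d"
      using nd unfolding norming_def by blast
    then obtain k where k: "k \<ge> 1" "d \<in> X k" "norm d = 1"
      by (auto simp: system_unit_vectors_def unit_vectors_def)
    \<comment> \<open>\<open>t d\<close> is the projection of \<open>x\<close> onto the real line spanned by \<open>d\<close>.\<close>
    define t where "t = re_inner x d"
    have "\<delta> * norm x \<le> t"
      using d False unfolding t_def re_inner_commute[of _ d] re_inner_scaleR_right
      by (simp add: field_simps)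
    moreover have "min \<delta> 1 * norm x \<le> \<delta> * norm x"
      by (simp add: mult_right_mono)
    ultimately have t: "min \<delta> 1 * norm x \<le> t" by simp
    then have "0 \<le> t"
      using m(1) by (smt (verit) mult_nonneg_nonneg norm_ge_zero)
    have "t \<le> norm x"
      using re_inner_le_norm[of x d] k(3) by (simp add: t_def)
    have "(min \<delta> 1 * norm x)\<^sup>2 \<le> t\<^sup>2"
      using t m(1) by (intro power_mono) simp_all
    moreover have "(norm (x - t *\<^sub>R d))\<^sup>2 = (norm x)\<^sup>2 - t\<^sup>2"
      unfolding norm_diff_scaleR_sq k(3) by (simp add: power2_eq_square flip: t_def)
    ultimately have "(norm (x - t *\<^sub>R d))\<^sup>2 \<le> (q * norm x)\<^sup>2"
      unfolding power_mult_distrib q2 by (simp add: algebra_simps)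
    then have "norm (x - t *\<^sub>R d) \<le> q * norm x"
      by (rule power2_le_imp_le) (simp add: \<open>0 \<le> q\<close>)
    moreover have "norm (t *\<^sub>R d) \<le> 1 * norm x"
      using \<open>t \<le> norm x\<close> \<open>0 \<le> t\<close> k(3) by simp
    moreover have "t *\<^sub>R d \<in> X k"
      using X[OF k(1)] k(2) by (simp add: real_vector.subspace_scale)
    ultimately show ?thesis
      using k(1) by blast
  qed
qed

section \<open>Absolutely representing systems are norming\<close>

lemma Baire_countable_closed_cover:
  fixes F :: "nat \<Rightarrow> 'a::{complete_space, metric_space} set"
  assumes "\<And>m. closed (F m)" "(\<Union>m. F m) = UNIV"
  obtains m a e where "e > 0" "ball a e \<subseteq> F m"
proof -
  have "\<exists>m. interior (F m) \<noteq> {}"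
  proof (rule ccontr)
    assume "\<not> (\<exists>m. interior (F m) \<noteq> {})"
    then have "euclidean interior_of \<Union>(range F) = {}"
      using assms(1)
      by (intro Baire_category_alt disjI1 completely_metrizable_space_euclidean) auto
    then show False
      using assms(2) by simp
  qed
  then show thesis
    using that by (metis equals0I mem_interior)
qed

lemma (in hilbert_space) norming_if_representing:
  fixes X :: "nat \<Rightarrow> 'v set"
  assumes X: "\<And>k. k \<ge> 1 \<Longrightarrow> real_vector.subspace (X k)"
    and rep: "absolutely_representing X"
  shows "\<exists>\<delta>>0. norming \<delta> (system_unit_vectors X)"
proof -
  let ?D = "system_unit_vectors X"
  define bounds where "bounds c x \<longleftrightarrow> 0 \<le> c \<and> (\<forall>d\<in>?D. re_inner x d \<le> c)" for c and x :: 'v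
  define F where "F m = {v. \<forall>c x. bounds c x \<longrightarrow> re_inner x v \<le> real m * c}" for m
  have piece: "re_inner x w \<le> c * norm w" if "bounds c x" "k \<ge> 1" "w \<in> X k" for c x w k
  proof (cases "w = 0")
    case True
    then show ?thesis by (simp add: re_inner_def)
  next
    case False
    have "(1 / norm w) *\<^sub>R w \<in> unit_vectors (X k)"
      using X[OF that(2)] that(3) False by (simp add: unit_vectors_def real_vector.subspace_scale)
    then have "(1 / norm w) *\<^sub>R w \<in> ?D"
      using that(2) by (auto simp: system_unit_vectors_def)
    then have "re_inner x ((1 / norm w) *\<^sub>R w) \<le> c"
      using that(1) unfolding bounds_def by blast
    then show ?thesis
      using False unfolding re_inner_scaleR_right by (simp add: field_simps)
  qed
  have cover: "\<exists>m. v \<in> F m" for v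
  proof -
    obtain y where y: "\<And>k. k \<ge> 1 \<Longrightarrow> y k \<in> X k" "summable (\<lambda>k. norm (y (Suc k)))"
        "(\<lambda>k. y (Suc k)) sums v"
      using rep unfolding absolutely_representing_def by metis
    obtain m where m: "(\<Sum>k. norm (y (Suc k))) \<le> real m"
      using real_arch_simple by blast
    have "re_inner x v \<le> real m * c" if b: "bounds c x" for c x
    proof -
      have "re_inner x v \<le> c * (\<Sum>k. norm (y (Suc k)))"
      proof (rule sums_le)
        show "re_inner x (y (Suc k)) \<le> c * norm (y (Suc k))" for k
          using b y(1) by (intro piece[of _ _ "Suc k"]) auto
        show "(\<lambda>k. re_inner x (y (Suc k))) sums re_inner x v"
          by (rule bounded_linear.sums[OF bounded_linear_re_inner y(3)])
        show "(\<lambda>k. c * norm (y (Suc k))) sums (c * (\<Sum>k. norm (y (Suc k))))"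
          using y(2) by (intro sums_mult summable_sums)
      qed
      also have "\<dots> \<le> c * real m"
        using m b by (intro mult_left_mono) (auto simp: bounds_def)
      finally show ?thesis by (simp add: mult.commute)
    qed
    then show ?thesis
      by (auto simp: F_def)
  qed
  have "closed (F m)" for m
    unfolding F_def re_inner_def
    by (intro closed_Collect_all closed_Collect_imp closed_Collect_le continuous_intros) auto
  moreover have "(\<Union>m. F m) = UNIV"
    using cover by auto
  ultimately obtain m a e where e: "e > 0" "ball a e \<subseteq> F m"
    by (rule Baire_countable_closed_cover)
  obtain m' where m': "- a \<in> F m'"
    using cover by blast
  define \<delta> where "\<delta> = e / 2 / (real m + real m' + 1)"
  have lower: "\<delta> \<le> c" if b: "bounds c x" and x: "norm x = 1" for c x
  proof -
    define w where "w = (e / 2) *\<^sub>R x"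
    have "a + w \<in> ball a e"
      using e(1) x by (simp add: w_def dist_norm)
    then have "re_inner x (a + w) \<le> real m * c"
      using e(2) b by (auto simp: F_def)
    moreover have "re_inner x (- a) \<le> real m' * c"
      using m' b by (auto simp: F_def)
    moreover have "re_inner x w = re_inner x (a + w) + re_inner x (- a)"
      by (simp flip: re_inner_add_right)
    moreover have "re_inner x w = e / 2"
      by (simp add: w_def re_inner_scaleR_right re_inner_self x)
    moreover have "0 \<le> c"
      using b by (simp add: bounds_def)
    ultimately have "e / 2 \<le> (real m + real m' + 1) * c"
      by (simp add: algebra_simps)
    then show ?thesis
      unfolding \<delta>_def by (simp add: field_simps)
  qed
  have "0 < \<delta>"
    using e(1) by (simp add: \<delta>_def)
  \<comment> \<open>Every bound being at least \<open>\<delta>\<close>, the number \<open>\<delta> / 2\<close> is not a bound.\<close>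
  moreover have "norming (\<delta> / 2) ?D"
    unfolding norming_def
  proof (intro allI impI)
    fix x :: 'v
    assume "norm x = 1"
    then have "\<not> bounds (\<delta> / 2) x"
      using lower \<open>0 < \<delta>\<close> by force
    then show "\<exists>d\<in>?D. \<delta> / 2 \<le> re_inner x d"
      using \<open>0 < \<delta>\<close> by (force simp: bounds_def)
  qed
  ultimately show ?thesis
    by (intro exI[of _ "\<delta> / 2"]) simp
qed

section \<open>The characterization\<close>

theorem mainTheorem11:
  fixes smul :: "'k::rc_scalar \<Rightarrow> 'v::banach \<Rightarrow> 'v"
    and ip :: "'v \<Rightarrow> 'v \<Rightarrow> 'k"
    and X :: "nat \<Rightarrow> 'v set"
    and \<tau> :: real
  assumes "hilbert_space smul ip"
    and "closed_subspace_system smul X"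
    and "\<tau> > 0"
  shows "absolutely_representing X \<longleftrightarrow>
    (\<exists>l. 0 < l \<and> l < sqrt (1 + \<tau>\<^sup>2) \<and>
      is_net l ((\<lambda>x. \<tau> *\<^sub>R x) ` system_unit_vectors X) (unit_vectors UNIV))"
proof -
  interpret hilbert_space smul ip by fact
  have X: "real_vector.subspace (X k) \<and> closed (X k)" if "k \<ge> 1" for k
    using assms(2) that real_subspace_if_subspace by (auto simp: closed_subspace_system_def)
  have "norm d = 1" if "d \<in> system_unit_vectors X" for d
    using that by (auto simp: system_unit_vectors_def unit_vectors_def)
  then have "(\<exists>l. 0 < l \<and> l < sqrt (1 + \<tau>\<^sup>2) \<and>
        is_net l ((\<lambda>x. \<tau> *\<^sub>R x) ` system_unit_vectors X) (unit_vectors UNIV))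
      \<longleftrightarrow> (\<exists>\<delta>>0. norming \<delta> (system_unit_vectors X))"
    using assms(3) by (rule net_iff_norming)
  also have "\<dots> \<longleftrightarrow> absolutely_representing X"
  proof
    assume "\<exists>\<delta>>0. norming \<delta> (system_unit_vectors X)"
    then obtain \<delta> where "\<delta> > 0" "norming \<delta> (system_unit_vectors X)"
      by (elim exE conjE)
    with X show "absolutely_representing X"
      by (rule representing_if_norming)
  next
    have "real_vector.subspace (X k)" if "k \<ge> 1" for k
      using X[OF that] by (rule conjunct1)
    moreover assume "absolutely_representing X"
    ultimately show "\<exists>\<delta>>0. norming \<delta> (system_unit_vectors X)"
      by (rule norming_if_representing)
  qed
  finally show ?thesis
    by (rule sym)
qed

end
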